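(* (i) For every triangle $K$, the parameters $\alpha_{ij},\beta_{ij},\gamma_{ij}$, $(i,j)\in\{(1,2),(2,3),(3,1)\}$, in the definition of the functions $$\Phi_{ij}=\lambda_i\nabla\lambda_j-\lambda_j\nabla\lambda_i+\alpha_{ij}\Phi^B_{ij}+\beta_{ij}\Phi^B_{jk}+\gamma_{ij}\Phi^B_{ki},\qquad \Phi^B_{ij}=\lambda_i\lambda_j\nabla\lambda_k,$$ where $k$ denotes the third index, can be chosen such that the normal component of each $\Phi_{ij}$ with respect to each edge of $K$ vanishes at the midpoint of that edge. With this choice, the local mass matrix on $K$, i.e. the Gram matrix of $\Phi_{12},\Phi_{23},\Phi_{31},\Phi^B_{12},\Phi^B_{23},\Phi^B_{31}$ with respect to $(\cdot,\cdot)_{h,K}$, is diagonal. (ii) For every rectangle $K$, the local mass matrix, i.e. the Gram matrix of the standard basis $\Phi_{h,1},\Phi_{h,2},\Phi_{v,1},\Phi_{v,2}$ of $\mathcal N_0(K)$ with respect to $(\cdot,\cdot)_{h,K}$, is diagonal. (iii) Consequently, the global mass matrix, i.e. the Gram matrix of the global basis of $\mathcal V_h$ assembled from these local basis functions with respect to $(\cdot,\cdot)_h$, is diagonal.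
   Context: Mesh. $\Omega\subset\mathbb R^2$ is a bounded Lipschitz polygon and $\mathcal T_h=\{K\}$ is a partition of $\Omega$ into (nondegenerate) triangles and/or axis-parallel rectangles (edges horizontal and vertical), where different elements meet only at common vertices or common whole edges. $\operatorname{curl}E=\partial_xE_2-\partial_yE_1$ and $H(\operatorname{curl};\Omega)=\{v\in L^2(\Omega)^2:\operatorname{curl}v\in L^2(\Omega)\}$. Local spaces. The lowest order Nédélec space is $\mathcal N_0(K)=\{(a-by,\,c+bx):a,b,c\in\mathbb R\}$ on a triangle and $\mathcal N_0(K)=\{(a+by,\,c+dx):a,b,c,d\in\mathbb R\}$ on a rectangle. On a triangle, $\lambda_1,\lambda_2,\lambda_3$ are the barycentric coordinates, the edge $e_k=e_{ij}$ joins vertices $i$ and $j$ and is opposite to vertex $k$, and $\mathcal N_0^+(K)=\mathcal N_0(K)+\operatorname{span}\{\Phi^B_{12},\Phi^B_{23},\Phi^B_{31}\}=\operatorname{span}\{\Phi_{12},\Phi_{23},\Phi_{31},\Phi^B_{12},\Phi^B_{23},\Phi^B_{31}\}$; indices are cyclic, i.e. $(i,j,k)$ is one of $(1,2,3),(2,3,1),(3,1,2)$. On a rectangle with horizontal edges $e_{h,1},e_{h,2}$ and vertical edges $e_{v,1},e_{v,2}$, the standard basis function $\Phi_{h,i}\in\mathcal N_0(K)$ has vanishing second component, tangential integral $1$ along $e_{h,i}$, and vanishes identically on the opposite horizontal edge; analogously $\Phi_{v,j}\in\mathcal N_0(K)$ has vanishing first component, tangential integral $1$ along $e_{v,j}$,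 and vanishes on the opposite vertical edge. Global space. $V(K)=\mathcal N_0(K)$ on rectangles, $V(K)=\mathcal N_0^+(K)$ on triangles, and $\mathcal V_h=\{v_h\in H(\operatorname{curl};\Omega):v_h|_K\in V(K)\ \forall K\in\mathcal T_h\}$. The global basis consists of: for each mesh edge $e$ with a fixed orientation, the function whose restriction to each element $K$ having $e$ as an edge is, up to sign, the local edge basis function ($\Phi_{ij}$, $\Phi_{h,i}$ or $\Phi_{v,j}$) associated with $e$, with the sign chosen so that its tangential integral along the oriented edge $e$ is $1$, and which is zero on all other elements; and for each triangle $K$, the three functions $\Phi^B_{12},\Phi^B_{23},\Phi^B_{31}$ of $K$ extended by zero. Quadrature. $(u,v)_h=\sum_{K\in\mathcal T_h}(u,v)_{h,K}$. On a triangle, $(u,v)_{h,K}=|K|\sum_{i=1}^3\frac13u(m_{K,i})\cdot v(m_{K,i})$, where $m_{K,i}$ is the midpoint of the edge opposite vertex $i$. On a rectangle, $(u,v)_{h,K}=|K|\big(\sum_{i=1}^2\frac12u_1(m_{K,h,i})v_1(m_{K,h,i})+\sum_{j=1}^2\frac12u_2(m_{K,v,j})v_2(m_{K,v,j})\big)$, where $m_{K,h,i}$ and $m_{K,v,j}$ are the midpoints of the horizontal and vertical edges, respectively. Point values are taken from the polynomial $u|_K$, $v|_K$. *)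

theory Defs
  imports "HOL-Analysis.Analysis"
begin

type_synonym vfield = "real^2 \<Rightarrow> real^2"

definition grad :: "(real^2 \<Rightarrow> real) \<Rightarrow> vfield" where
  "grad f x = (THE D. GDERIV f x :> D)"

definition tangential_integral :: "(real^2) \<times> (real^2) \<Rightarrow> vfield \<Rightarrow> real" where
  "tangential_integral pq F =
     integral {0..1} (\<lambda>t. F (linepath (fst pq) (snd pq) t) \<bullet> (snd pq - fst pq))"

definition gram :: "('u \<Rightarrow> 'u \<Rightarrow> real) \<Rightarrow> ('i \<Rightarrow> 'u) \<Rightarrow> 'i \<Rightarrow> 'i \<Rightarrow> real" where
  "gram B \<phi> i j = B (\<phi> i) (\<phi> j)"

definition diagonal_on :: "'i set \<Rightarrow> ('i \<Rightarrow> 'i \<Rightarrow> real) \<Rightarrow> bool" where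
  "diagonal_on I A \<longleftrightarrow> (\<forall>i\<in>I. \<forall>j\<in>I. i \<noteq> j \<longrightarrow> A i j = 0)"


text \<open>
  A triangle is given by its numbered vertices. Arithmetic in the index type \<open>3\<close> is modulo 3,
  so \<open>(i, i + 1, i + 2)\<close> runs through the cyclic triples (1,2,3), (2,3,1), (3,1,2). Families
  indexed by the pairs \<open>(i,j)\<close> = (1,2), (2,3), (3,1) are indexed by \<open>i\<close>, with \<open>j = i + 1\<close> and
  \<open>k = i + 2\<close>.
\<close>

definition nondegenerate :: "real^2^3 \<Rightarrow> bool" where
  "nondegenerate v \<longleftrightarrow> \<not> collinear (range (($) v))"

definition bary :: "real^2^3 \<Rightarrow> 3 \<Rightarrow> real^2 \<Rightarrow> real" where
  "bary v i x =
     (THE l :: real^3. (\<Sum>j\<in>UNIV. l$j) = 1 \<and> (\<Sum>j\<in>UNIV. l$j *\<^sub>R v$j) = x) $ i"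

definition tri_edge :: "real^2^3 \<Rightarrow> 3 \<Rightarrow> (real^2) \<times> (real^2)" where
  "tri_edge v i = (v$i, v$(i + 1))"

definition tri_midpoint :: "real^2^3 \<Rightarrow> 3 \<Rightarrow> real^2" where
  "tri_midpoint v i = midpoint (v$(i + 1)) (v$(i + 2))"

definition tri_bubble :: "real^2^3 \<Rightarrow> 3 \<Rightarrow> vfield" where
  "tri_bubble v i x = (bary v i x * bary v (i + 1) x) *\<^sub>R grad (bary v (i + 2)) x"

definition tri_edge_fun ::
  "real^2^3 \<Rightarrow> (3 \<Rightarrow> real) \<Rightarrow> (3 \<Rightarrow> real) \<Rightarrow> (3 \<Rightarrow> real) \<Rightarrow> 3 \<Rightarrow> vfield" where
  "tri_edge_fun v \<alpha> \<beta> \<gamma> i x =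
     bary v i x *\<^sub>R grad (bary v (i + 1)) x - bary v (i + 1) x *\<^sub>R grad (bary v i) x
     + \<alpha> i *\<^sub>R tri_bubble v i x + \<beta> i *\<^sub>R tri_bubble v (i + 1) x
     + \<gamma> i *\<^sub>R tri_bubble v (i + 2) x"

definition normal_components_vanish ::
  "real^2^3 \<Rightarrow> (3 \<Rightarrow> real) \<Rightarrow> (3 \<Rightarrow> real) \<Rightarrow> (3 \<Rightarrow> real) \<Rightarrow> bool" where
  "normal_components_vanish v \<alpha> \<beta> \<gamma> \<longleftrightarrow>
     (\<forall>i l n. norm n = 1 \<and> n \<bullet> (v$(l + 2) - v$(l + 1)) = 0 \<longrightarrow>
        tri_edge_fun v \<alpha> \<beta> \<gamma> i (tri_midpoint v l) \<bullet> n = 0)"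

datatype tri_dof = Tri_Edge 3 | Tri_Bubble 3

primrec tri_basis ::
  "real^2^3 \<Rightarrow> (3 \<Rightarrow> real) \<Rightarrow> (3 \<Rightarrow> real) \<Rightarrow> (3 \<Rightarrow> real) \<Rightarrow> tri_dof \<Rightarrow> vfield" where
  "tri_basis v \<alpha> \<beta> \<gamma> (Tri_Edge i) = tri_edge_fun v \<alpha> \<beta> \<gamma> i"
| "tri_basis v \<alpha> \<beta> \<gamma> (Tri_Bubble i) = tri_bubble v i"

definition N0_tri :: "vfield set" where
  "N0_tri = {u. \<exists>a b c. \<forall>x. u x = vector [a - b * x$2, c + b * x$1]}"

definition N0_plus :: "real^2^3 \<Rightarrow> vfield set" where
  "N0_plus v = {\<lambda>x. u x + (\<Sum>i\<in>UNIV. c i *\<^sub>R tri_bubble v i x) | u c. u \<in> N0_tri}"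


text \<open>
  A rectangle is given by its lower left corner \<open>a\<close> and its upper right corner \<open>b\<close>. Horizontal
  edges are numbered 1 (bottom), 2 (top), vertical edges 1 (left), 2 (right); in the index type
  \<open>2\<close> the number of the opposite edge is \<open>i + 1\<close>.
\<close>

definition proper_rect :: "real^2 \<Rightarrow> real^2 \<Rightarrow> bool" where
  "proper_rect a b \<longleftrightarrow> a$1 < b$1 \<and> a$2 < b$2"

datatype rect_dof = Hor 2 | Ver 2

primrec rect_edge :: "real^2 \<Rightarrow> real^2 \<Rightarrow> rect_dof \<Rightarrow> (real^2) \<times> (real^2)" where
  "rect_edge a b (Hor i) =
     (let y = (if i = 1 then a$2 else b$2) in (vector [a$1, y], vector [b$1, y]))"
| "rect_edge a b (Ver j) =
     (let x = (if j = 1 then a$1 else b$1) in (vector [x, a$2], vector [x, b$2]))"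

definition rect_midpoint :: "real^2 \<Rightarrow> real^2 \<Rightarrow> rect_dof \<Rightarrow> real^2" where
  "rect_midpoint a b d = midpoint (fst (rect_edge a b d)) (snd (rect_edge a b d))"

definition N0_rect :: "vfield set" where
  "N0_rect = {u. \<exists>a b c d. \<forall>x. u x = vector [a + b * x$2, c + d * x$1]}"

primrec rect_basis :: "real^2 \<Rightarrow> real^2 \<Rightarrow> rect_dof \<Rightarrow> vfield" where
  "rect_basis a b (Hor i) = (THE \<Phi>. \<Phi> \<in> N0_rect \<and> (\<forall>x. \<Phi> x $ 2 = 0) \<and>
     tangential_integral (rect_edge a b (Hor i)) \<Phi> = 1 \<and>
     (\<forall>x \<in> closed_segment (fst (rect_edge a b (Hor (i + 1)))) (snd (rect_edge a b (Hor (i + 1)))).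
        \<Phi> x = 0))"
| "rect_basis a b (Ver j) = (THE \<Phi>. \<Phi> \<in> N0_rect \<and> (\<forall>x. \<Phi> x $ 1 = 0) \<and>
     tangential_integral (rect_edge a b (Ver j)) \<Phi> = 1 \<and>
     (\<forall>x \<in> closed_segment (fst (rect_edge a b (Ver (j + 1)))) (snd (rect_edge a b (Ver (j + 1)))).
        \<Phi> x = 0))"


datatype element = Triangle "real^2^3" | Rectangle "real^2" "real^2"

primrec valid_element :: "element \<Rightarrow> bool" where
  "valid_element (Triangle v) = nondegenerate v"
| "valid_element (Rectangle a b) = proper_rect a b"

primrec region :: "element \<Rightarrow> (real^2) set" where
  "region (Triangle v) = convex hull (range (($) v))"
| "region (Rectangle a b) = cbox a b"

text \<open>A mesh edge is represented by the set of its two endpoints.\<close>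

definition endpoints :: "(real^2) \<times> (real^2) \<Rightarrow> (real^2) set" where
  "endpoints pq = {fst pq, snd pq}"

primrec edges :: "element \<Rightarrow> (real^2) set set" where
  "edges (Triangle v) = range (\<lambda>i. endpoints (tri_edge v i))"
| "edges (Rectangle a b) = range (\<lambda>d. endpoints (rect_edge a b d))"

definition vertices :: "element \<Rightarrow> (real^2) set" where
  "vertices K = \<Union> (edges K)"

primrec local_space :: "element \<Rightarrow> vfield set" where
  "local_space (Triangle v) = N0_plus v"
| "local_space (Rectangle a b) = N0_rect"

primrec local_quad :: "element \<Rightarrow> vfield \<Rightarrow> vfield \<Rightarrow> real" where
  "local_quad (Triangle v) u w = measure lebesgue (region (Triangle v)) *
     (\<Sum>i\<in>UNIV. 1/3 * (u (tri_midpoint v i) \<bullet> w (tri_midpoint v i)))"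
| "local_quad (Rectangle a b) u w = measure lebesgue (region (Rectangle a b)) *
     ((\<Sum>i\<in>UNIV. 1/2 * (u (rect_midpoint a b (Hor i)) $ 1 * w (rect_midpoint a b (Hor i)) $ 1)) +
      (\<Sum>j\<in>UNIV. 1/2 * (u (rect_midpoint a b (Ver j)) $ 2 * w (rect_midpoint a b (Ver j)) $ 2)))"


definition lipschitz_domain :: "(real^2) set \<Rightarrow> bool" where
  "lipschitz_domain \<Omega> \<longleftrightarrow> open \<Omega> \<and> connected \<Omega> \<and> \<Omega> \<noteq> {} \<and>
     (\<forall>p \<in> frontier \<Omega>. \<exists>r > 0. \<exists>(Q :: real^2 \<Rightarrow> real^2) (g :: real \<Rightarrow> real) L.
        orthogonal_transformation Q \<and> L-lipschitz_on UNIV g \<and>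
        (\<forall>x \<in> ball p r. x \<in> \<Omega> \<longleftrightarrow> Q (x - p) $ 2 < g (Q (x - p) $ 1)))"

definition bounded_lipschitz_polygon :: "(real^2) set \<Rightarrow> bool" where
  "bounded_lipschitz_polygon \<Omega> \<longleftrightarrow> bounded \<Omega> \<and> lipschitz_domain \<Omega> \<and>
     (\<exists>S. finite S \<and> frontier \<Omega> = (\<Union>(p, q)\<in>S. closed_segment p q))"

definition mesh :: "(real^2) set \<Rightarrow> element set \<Rightarrow> bool" where
  "mesh \<Omega> T \<longleftrightarrow> finite T \<and> (\<forall>K\<in>T. valid_element K) \<and> (\<Union>K\<in>T. region K) = closure \<Omega> \<and>
     (\<forall>K\<in>T. \<forall>K'\<in>T. K \<noteq> K' \<longrightarrow>
        region K \<inter> region K' = {} \<or>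
        (\<exists>p \<in> vertices K \<inter> vertices K'. region K \<inter> region K' = {p}) \<or>
        (\<exists>e \<in> edges K \<inter> edges K'. region K \<inter> region K' = convex hull e))"

definition mesh_edges :: "element set \<Rightarrow> (real^2) set set" where
  "mesh_edges T = (\<Union>K\<in>T. edges K)"

definition edge_orientation ::
  "element set \<Rightarrow> ((real^2) set \<Rightarrow> (real^2) \<times> (real^2)) \<Rightarrow> bool" where
  "edge_orientation T ori \<longleftrightarrow> (\<forall>e \<in> mesh_edges T. endpoints (ori e) = e)"

text \<open>
  Piecewise polynomial fields are in general two-valued on edges. The polynomial \<open>u|\<^sub>K\<close> is
  recovered from the values of \<open>u\<close> in the interior of \<open>K\<close>; by continuity its values on \<open>K\<close>
  do not depend on the choice.
\<close>

definition restriction :: "element \<Rightarrow> vfield \<Rightarrow> vfield" where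
  "restriction K u = (SOME p. p \<in> local_space K \<and> (\<forall>x \<in> interior (region K). u x = p x))"

definition global_quad :: "element set \<Rightarrow> vfield \<Rightarrow> vfield \<Rightarrow> real" where
  "global_quad T u w = (\<Sum>K\<in>T. local_quad K (restriction K u) (restriction K w))"

text \<open>
  The arguments \<open>\<alpha>\<close>, \<open>\<beta>\<close>, \<open>\<gamma>\<close> below assign to every triangle its own parameters.
\<close>

primrec local_edge_fun ::
  "(real^2^3 \<Rightarrow> 3 \<Rightarrow> real) \<Rightarrow> (real^2^3 \<Rightarrow> 3 \<Rightarrow> real) \<Rightarrow> (real^2^3 \<Rightarrow> 3 \<Rightarrow> real) \<Rightarrow>
   (real^2) set \<Rightarrow> element \<Rightarrow> vfield" where
  "local_edge_fun \<alpha> \<beta> \<gamma> e (Triangle v) =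
     tri_edge_fun v (\<alpha> v) (\<beta> v) (\<gamma> v) (THE i. endpoints (tri_edge v i) = e)"
| "local_edge_fun \<alpha> \<beta> \<gamma> e (Rectangle a b) =
     rect_basis a b (THE d. endpoints (rect_edge a b d) = e)"

definition edge_sign :: "(real^2) \<times> (real^2) \<Rightarrow> vfield \<Rightarrow> real" where
  "edge_sign pq F =
     (THE s. s \<in> {1, -1} \<and> tangential_integral pq (\<lambda>x. s *\<^sub>R F x) = 1)"

definition zero_ext :: "element \<Rightarrow> vfield \<Rightarrow> vfield" where
  "zero_ext K F x = (if x \<in> interior (region K) then F x else 0)"

datatype dof = Edge_Dof "(real^2) set" | Bubble_Dof "real^2^3" 3

definition dofs :: "element set \<Rightarrow> dof set" where
  "dofs T = Edge_Dof ` mesh_edges T \<union> {Bubble_Dof v i | v i. Triangle v \<in> T}"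

primrec global_basis ::
  "element set \<Rightarrow> (real^2^3 \<Rightarrow> 3 \<Rightarrow> real) \<Rightarrow> (real^2^3 \<Rightarrow> 3 \<Rightarrow> real) \<Rightarrow> (real^2^3 \<Rightarrow> 3 \<Rightarrow> real) \<Rightarrow>
   ((real^2) set \<Rightarrow> (real^2) \<times> (real^2)) \<Rightarrow> dof \<Rightarrow> vfield" where
  "global_basis T \<alpha> \<beta> \<gamma> ori (Edge_Dof e) =
     (\<lambda>x. \<Sum>K \<in> {K \<in> T. e \<in> edges K}.
        zero_ext K (\<lambda>y. edge_sign (ori e) (local_edge_fun \<alpha> \<beta> \<gamma> e K) *\<^sub>R
                        local_edge_fun \<alpha> \<beta> \<gamma> e K y) x)"
| "global_basis T \<alpha> \<beta> \<gamma> ori (Bubble_Dof v i) = zero_ext (Triangle v) (tri_bubble v i)"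

end

theory Submission
  imports Defs
begin

text \<open>
  At the midpoint of the edge opposite vertex \<open>l\<close> the barycentric coordinates are \<open>0, 1/2, 1/2\<close>,
  so exactly one bubble survives there, with value \<open>1/4 \<nabla>\<lambda>\<^sub>l\<close>, which is normal to the edge. Hence each
  of the nine normal components of the edge functions at the midpoints is corrected to zero by
  exactly one parameter. Once this is done, edge functions are tangential and bubbles are normal at
  every midpoint, and an edge function also has zero tangential component at the midpoints of the
  other two edges, so it vanishes there: no two basis functions interact at a quadrature point. On a
  rectangle the basis function of an edge is parallel to this edge and vanishes on the opposite one,
  so the component along an edge, taken at its midpoint, vanishes for all other basis functions.

  For a mesh, the elements have pairwise disjoint interiors, and by continuity the polynomial on an
  element is determined at the quadrature points by its values in the interior. The global mass
  matrix is therefore assembled from multiples of the entries of the local ones.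
\<close>

section \<open>The Euclidean plane\<close>

lemma inner_vec_2: "x \<bullet> y = x$1 * y$1 + x$2 * y$2" for x y :: "real^2"
  by (simp add: inner_vec_def sum_2)

lemma vec_eq_iff_2: "x = y \<longleftrightarrow> x$1 = y$1 \<and> x$2 = y$2" for x y :: "'a^2"
  by (simp add: vec_eq_iff forall_2)

lemma orthogonal_same_imp_parallel_2D:
  fixes t g n :: "'a::euclidean_space"
  assumes "DIM('a) = 2" "t \<noteq> 0" "g \<noteq> 0" "g \<bullet> t = 0" "n \<bullet> t = 0"
  obtains c where "n = c *\<^sub>R g"
proof -
  have "g \<noteq> t" using assms(3,4) by auto
  have "pairwise orthogonal {g, t}"
    using assms(4) by (simp add: pairwise_insert orthogonal_def inner_commute)
  then have "independent {g, t}"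
    using assms(2,3) by (intro pairwise_orthogonal_independent) auto
  then have "span {g, t} = UNIV"
    using assms(1) \<open>g \<noteq> t\<close> by (simp add: dim_eq_card_independent flip: dim_eq_full)
  then have "n \<in> span {g, t}" by simp
  then obtain a b where decomposition: "n = a *\<^sub>R g + b *\<^sub>R t"
    unfolding span_breakdown_eq span_singleton by (auto simp: algebra_simps)
  then have "b = 0" using assms(2,4,5) by (simp add: inner_add_left)
  with decomposition show thesis by (intro that[of a]) simp
qed

definition perp :: "real^2 \<Rightarrow> real^2" where
  "perp x = vector [- x$2, x$1]"

lemma perp_inner_self [simp]: "perp x \<bullet> x = 0" "x \<bullet> perp x = 0"
  by (simp_all add: perp_def inner_vec_2)

lemma perp_eq_0_iff [simp]: "perp x = 0 \<longleftrightarrow> x = 0"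
  by (auto simp: perp_def vec_eq_iff_2)

lemma linear_perp: "linear perp"
  by (rule linearI) (simp_all add: perp_def vec_eq_iff_2)

lemma collinear_if_perp_inner_eq_0:
  fixes x y :: "real^2"
  assumes "perp x \<bullet> y = 0"
  shows "collinear {0, x, y}"
proof (cases "x = 0")
  case False
  have "\<exists>c. y = c *\<^sub>R x"
    by (rule orthogonal_same_imp_parallel_2D[of "perp x" x y])
      (use False assms in \<open>auto simp: inner_commute\<close>)
  then show ?thesis by (auto simp: collinear_lemma)
qed simp

lemma inner_scaleR_diff_eq_perp: "(g \<bullet> x) *\<^sub>R h - (h \<bullet> x) *\<^sub>R g = (perp g \<bullet> h) *\<^sub>R perp x"
  by (simp add: perp_def vec_eq_iff_2 inner_vec_2 algebra_simps)


section \<open>Triangles\<close>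

lemma cyclic_cases:
  fixes l i :: 3
  obtains "l = i" | "l = i + 1" | "l = i + 2"
  using exhaust_3[of i] exhaust_3[of l] by fastforce

lemma cyclic_simps [simp]: "i + 1 + 1 = i + 2" "i + 1 + 2 = i" "i + 2 + 1 = i" "i + 2 + 2 = i + 1"
  "i + 1 \<noteq> i" "i + 2 \<noteq> i" "i + 1 \<noteq> i + 2" "i + 2 \<noteq> i + 1"
  for i :: 3
  using exhaust_3[of i] by auto

lemma UNIV_cyclic: "UNIV = {i, i + 1, i + 2}" for i :: 3
  by (auto intro: cyclic_cases)

lemma sum_cyclic: "sum f UNIV = f i + f (i + 1) + f (i + 2)" for i :: 3
  and f :: "3 \<Rightarrow> 'a::comm_monoid_add"
  by (subst UNIV_cyclic[of i]) (simp add: add.assoc)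

lemma range_vec_nth_3: "range (($) v) = {v$i, v$(i+1), v$(i+2)}" for v :: "'a^3"
  by (subst UNIV_cyclic[of i]) simp

definition bary_grad :: "real^2^3 \<Rightarrow> 3 \<Rightarrow> real^2" where
  "bary_grad v i = (let n = perp (v$(i+2) - v$(i+1)) in n /\<^sub>R (n \<bullet> (v$i - v$(i+1))))"

context
  fixes v :: "real^2^3"
  assumes nondegenerate: "nondegenerate v"
begin

lemma not_collinear_vertices: "\<not> collinear {v$i, v$(i+1), v$(i+2)}"
  using nondegenerate by (simp add: nondegenerate_def range_vec_nth_3[of v i])

lemma inj_vertices: "inj (($) v)"
proof (rule injI)
  fix i j assume "v$i = v$j"
  then show "i = j"
    using not_collinear_vertices[of i]
    unfolding collinear_3_eq_affine_dependent by (cases j i rule: cyclic_cases) metis+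
qed

lemma card_vertices: "card (range (($) v)) = 3"
  by (simp add: card_image inj_vertices)

lemma affine_independent_vertices: "\<not> affine_dependent (range (($) v))"
  using not_collinear_vertices[of 1]
  by (simp add: range_vec_nth_3[of v 1] collinear_3_eq_affine_dependent)

lemma edge_vector_nonzero: "v$(l+2) - v$(l+1) \<noteq> 0"
  using inj_eq[OF inj_vertices] by simp

lemma bary_grad_inner_vertex_diff: "bary_grad v i \<bullet> (v$j - v$k) = of_bool (j = i) - of_bool (k = i)"
proof -
  let ?n = "perp (v$(i+2) - v$(i+1))"
  have "\<not> collinear {v$(i+2), v$(i+1), v$i}"
    using not_collinear_vertices[of i] by (simp add: insert_commute)
  then have "?n \<bullet> (v$i - v$(i+1)) \<noteq> 0"
    using collinear_if_perp_inner_eq_0 by (auto simp: collinear_3[of "v$(i+2)"])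
  then have "bary_grad v i \<bullet> (v$i - v$(i+1)) = 1" by (simp add: bary_grad_def Let_def)
  moreover have "bary_grad v i \<bullet> (v$(i+2) - v$(i+1)) = 0" by (simp add: bary_grad_def Let_def)
  ultimately show ?thesis
    by (cases j i rule: cyclic_cases; cases k i rule: cyclic_cases) (simp_all add: inner_diff_right)
qed

lemma bary_grad_nonzero: "bary_grad v i \<noteq> 0"
  using bary_grad_inner_vertex_diff[of i i "i+1"] by auto

lemma barycentric_coordinates_exist:
  obtains l :: "real^3" where "(\<Sum>j\<in>UNIV. l$j) = 1" "(\<Sum>j\<in>UNIV. l$j *\<^sub>R v$j) = x"
proof -
  have "affine hull range (($) v) = UNIV"
    using affine_independent_span_eq[OF affine_independent_vertices]
    by (simp only: card_vertices) simp
  then have "x \<in> affine hull {v$1, v$2, v$3}"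
    by (simp add: range_vec_nth_3[of v 1])
  then obtain a b c where "a + b + c = 1" "x = a *\<^sub>R v$1 + b *\<^sub>R v$2 + c *\<^sub>R v$3"
    unfolding affine_hull_3 by blast
  then show thesis
    by (intro that[of "vector [a, b, c]"]) (simp_all add: sum_3)
qed

lemma bary_grad_inner_affine_combination:
  assumes "(\<Sum>j\<in>UNIV. l j) = 1"
  shows "bary_grad v i \<bullet> ((\<Sum>j\<in>UNIV. l j *\<^sub>R v$j) - v$(i+1)) = l i"
proof -
  have "(\<Sum>j\<in>UNIV. l j *\<^sub>R v$j) - v$(i+1) = (\<Sum>j\<in>UNIV. l j *\<^sub>R (v$j - v$(i+1)))"
    using assms by (simp add: scaleR_diff_right sum_subtractf flip: scaleR_left.sum)
  then show ?thesis
    by (simp add: inner_sum_right bary_grad_inner_vertex_diff)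
qed

lemma bary_eq_inner: "bary v i x = bary_grad v i \<bullet> (x - v$(i+1))"
proof -
  let ?coords = "\<lambda>l :: real^3. (\<Sum>j\<in>UNIV. l$j) = 1 \<and> (\<Sum>j\<in>UNIV. l$j *\<^sub>R v$j) = x"
  have coords: "l$i = bary_grad v i \<bullet> (x - v$(i+1))" if "?coords l" for l i
    using bary_grad_inner_affine_combination[of "($) l" i] that by simp
  obtain l where coords_l: "?coords l" by (rule barycentric_coordinates_exist[of x]) blast
  have "m = l" if "?coords m" for m
    unfolding vec_eq_iff using coords[OF that] coords[OF coords_l] by simp
  with coords_l have "(THE l. ?coords l) = l" by (rule the_equality)
  then show ?thesis by (simp only: bary_def coords[OF coords_l])
qed

lemma bary_midpoint: "bary v i (tri_midpoint v l) = (if i = l then 0 else 1/2)"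
proof -
  have "tri_midpoint v l - v$(i+1) = (1/2) *\<^sub>R ((v$(l+1) - v$(i+1)) + (v$(l+2) - v$(i+1)))"
    by (simp add: tri_midpoint_def midpoint_def vec_eq_iff_2 field_simps)
  then have "bary v i (tri_midpoint v l) = 1/2 * (of_bool (l + 1 = i) + of_bool (l + 2 = i))"
    by (simp only: bary_eq_inner inner_scaleR_right inner_add_right bary_grad_inner_vertex_diff) simp
  then show ?thesis by (cases i l rule: cyclic_cases) simp_all
qed

lemma grad_bary: "grad (bary v i) x = bary_grad v i"
proof -
  have deriv: "GDERIV (bary v i) x :> bary_grad v i"
    unfolding bary_eq_inner[abs_def] gderiv_def
    by (auto simp: inner_commute intro!: derivative_eq_intros)
  have "D = bary_grad v i" if "GDERIV (bary v i) x :> D" for D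
  proof -
    have "(\<lambda>h. h \<bullet> D) = (\<lambda>h. h \<bullet> bary_grad v i)"
      using has_derivative_unique that deriv unfolding gderiv_def by blast
    then show ?thesis using vector_eq_ldot[of D "bary_grad v i"] by (simp add: fun_eq_iff)
  qed
  with deriv show ?thesis unfolding grad_def by (rule the_equality)
qed

lemma tri_bubble_midpoint:
  "tri_bubble v i (tri_midpoint v l) = (if l = i + 2 then (1/4) *\<^sub>R bary_grad v l else 0)"
  by (cases l i rule: cyclic_cases) (simp_all add: tri_bubble_def grad_bary bary_midpoint)

lemma tri_edge_fun_tangential_midpoint:
  assumes "l \<noteq> i + 2"
  shows "tri_edge_fun v \<alpha> \<beta> \<gamma> i (tri_midpoint v l) \<bullet> (v$(l+2) - v$(l+1)) = 0"
  using assms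
  by (cases l i rule: cyclic_cases)
    (simp_all add: tri_edge_fun_def grad_bary tri_bubble_midpoint bary_midpoint
      bary_grad_inner_vertex_diff inner_add_left inner_diff_left)

lemma normal_to_edge_imp_parallel_bary_grad:
  assumes "n \<bullet> (v$(l+2) - v$(l+1)) = 0"
  obtains c where "n = c *\<^sub>R bary_grad v l"
proof (rule orthogonal_same_imp_parallel_2D)
  show "bary_grad v l \<bullet> (v$(l+2) - v$(l+1)) = 0" by (simp add: bary_grad_inner_vertex_diff)
qed (use assms edge_vector_nonzero bary_grad_nonzero that in simp_all)

lemma normal_components_vanish_iff:
  "normal_components_vanish v \<alpha> \<beta> \<gamma> \<longleftrightarrow>
    (\<forall>i l. tri_edge_fun v \<alpha> \<beta> \<gamma> i (tri_midpoint v l) \<bullet> bary_grad v l = 0)"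
proof (intro iffI allI)
  fix i l
  let ?n = "sgn (bary_grad v l)"
  assume "normal_components_vanish v \<alpha> \<beta> \<gamma>"
  moreover have "norm ?n = 1" "?n \<bullet> (v$(l+2) - v$(l+1)) = 0"
    by (simp_all add: norm_sgn bary_grad_nonzero sgn_div_norm bary_grad_inner_vertex_diff)
  ultimately have "tri_edge_fun v \<alpha> \<beta> \<gamma> i (tri_midpoint v l) \<bullet> ?n = 0"
    unfolding normal_components_vanish_def by blast
  then show "tri_edge_fun v \<alpha> \<beta> \<gamma> i (tri_midpoint v l) \<bullet> bary_grad v l = 0"
    by (simp add: sgn_div_norm bary_grad_nonzero)
next
  assume normal: "\<forall>i l. tri_edge_fun v \<alpha> \<beta> \<gamma> i (tri_midpoint v l) \<bullet> bary_grad v l = 0"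
  show "normal_components_vanish v \<alpha> \<beta> \<gamma>"
    unfolding normal_components_vanish_def
  proof (intro allI impI, elim conjE)
    fix i l n
    assume "n \<bullet> (v$(l+2) - v$(l+1)) = 0"
    then obtain c where "n = c *\<^sub>R bary_grad v l"
      by (rule normal_to_edge_imp_parallel_bary_grad)
    then show "tri_edge_fun v \<alpha> \<beta> \<gamma> i (tri_midpoint v l) \<bullet> n = 0"
      using normal by simp
  qed
qed

lemma normal_components_vanish_exists: "\<exists>\<alpha> \<beta> \<gamma>. normal_components_vanish v \<alpha> \<beta> \<gamma>"
proof -
  define uncorrected where "uncorrected i l =
    tri_edge_fun v (\<lambda>_. 0) (\<lambda>_. 0) (\<lambda>_. 0) i (tri_midpoint v l)" for i l
  define correction where "correction i l =
    - 4 * (uncorrected i l \<bullet> bary_grad v l) / (bary_grad v l \<bullet> bary_grad v l)" for i l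
  let ?E = "tri_edge_fun v (\<lambda>i. correction i (i+2)) (\<lambda>i. correction i i)
    (\<lambda>i. correction i (i+1))"
  have "?E i (tri_midpoint v l)
      = uncorrected i l + (correction i l / 4) *\<^sub>R bary_grad v l" for i l
    by (cases l i rule: cyclic_cases)
      (simp_all add: uncorrected_def tri_edge_fun_def tri_bubble_midpoint)
  moreover have "correction i l / 4 * (bary_grad v l \<bullet> bary_grad v l)
      = - (uncorrected i l \<bullet> bary_grad v l)" for i l
    by (simp add: correction_def bary_grad_nonzero)
  ultimately have "?E i (tri_midpoint v l) \<bullet> bary_grad v l = 0" for i l
    by (simp add: inner_add_left)
  then show ?thesis using normal_components_vanish_iff by blast
qed

context
  fixes \<alpha> \<beta> \<gamma> :: "3 \<Rightarrow> real"
  assumes normal_components_vanish: "normal_components_vanish v \<alpha> \<beta> \<gamma>"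
begin

lemma tri_edge_fun_midpoint_inner_bary_grad:
  "tri_edge_fun v \<alpha> \<beta> \<gamma> i (tri_midpoint v l) \<bullet> bary_grad v l = 0"
  using normal_components_vanish normal_components_vanish_iff by blast

lemma tri_edge_fun_midpoint_eq_0:
  assumes "l \<noteq> i + 2"
  shows "tri_edge_fun v \<alpha> \<beta> \<gamma> i (tri_midpoint v l) = 0"
proof -
  obtain c where "tri_edge_fun v \<alpha> \<beta> \<gamma> i (tri_midpoint v l) = c *\<^sub>R bary_grad v l"
    by (rule normal_to_edge_imp_parallel_bary_grad[OF tri_edge_fun_tangential_midpoint[OF assms]])
  then show ?thesis
    using tri_edge_fun_midpoint_inner_bary_grad[of i l] bary_grad_nonzero[of l] by auto
qed

lemma tri_basis_orthogonal_midpoint: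
  assumes "p \<noteq> q"
  shows "tri_basis v \<alpha> \<beta> \<gamma> p (tri_midpoint v l) \<bullet> tri_basis v \<alpha> \<beta> \<gamma> q (tri_midpoint v l) = 0"
proof -
  have edge_edge:
    "tri_edge_fun v \<alpha> \<beta> \<gamma> i (tri_midpoint v l) \<bullet> tri_edge_fun v \<alpha> \<beta> \<gamma> j (tri_midpoint v l) = 0"
    if "i \<noteq> j" for i j
    using that tri_edge_fun_midpoint_eq_0[of l i] tri_edge_fun_midpoint_eq_0[of l j] by fastforce
  have edge_bubble: "tri_edge_fun v \<alpha> \<beta> \<gamma> i (tri_midpoint v l) \<bullet> tri_bubble v j (tri_midpoint v l) = 0"
    for i j
    by (simp add: tri_bubble_midpoint tri_edge_fun_midpoint_inner_bary_grad)
  have bubble_bubble: "tri_bubble v i (tri_midpoint v l) \<bullet> tri_bubble v j (tri_midpoint v l) = 0"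
    if "i \<noteq> j" for i j
    using that by (simp add: tri_bubble_midpoint)
  show ?thesis
    using assms edge_bubble
    by (cases p; cases q) (simp_all add: edge_edge bubble_bubble inner_commute)
qed

lemma tri_mass_matrix_diagonal:
  "diagonal_on UNIV (gram (local_quad (Triangle v)) (tri_basis v \<alpha> \<beta> \<gamma>))"
  by (simp add: diagonal_on_def gram_def tri_basis_orthogonal_midpoint)

end

end


section \<open>Rectangles\<close>

lemma three_eq_one_2 [simp]: "(3::2) = 1"
  by simp

lemma add_1_neq_self_2 [simp]: "k + 1 \<noteq> k" for k :: 2
  using exhaust_2[of k] by auto

lemma eq_or_eq_add_1: "j = k \<or> j = k + 1" for j k :: 2
  using exhaust_2[of j] exhaust_2[of k] by auto

lemma N0_rect_iff: "u \<in> N0_rect \<longleftrightarrow> (\<exists>p q. \<forall>x k. u x $ k = p k + q k * x $ (k + 1))"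
proof
  assume "u \<in> N0_rect"
  then obtain a b c d where "\<And>x. u x = vector [a + b * x$2, c + d * x$1]"
    unfolding N0_rect_def by blast
  then have "\<forall>x k. u x $ k = (if k = 1 then a else c) + (if k = 1 then b else d) * x $ (k + 1)"
    by (simp add: forall_2)
  then show "\<exists>p q. \<forall>x k. u x $ k = p k + q k * x $ (k + 1)" by (intro exI)
next
  assume "\<exists>p q. \<forall>x k. u x $ k = p k + q k * x $ (k + 1)"
  then obtain p q where "\<And>x k. u x $ k = p k + q k * x $ (k + 1)" by blast
  then have "\<forall>x. u x = vector [p 1 + q 1 * x$2, p 2 + q 2 * x$1]"
    by (simp add: vec_eq_iff_2)
  then show "u \<in> N0_rect" unfolding N0_rect_def by blast
qed

lemma tangential_integral_N0_rect:
  assumes "u \<in> N0_rect" "P$(k+1) = Q$(k+1)"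
  shows "tangential_integral (P, Q) u = u P $ k * (Q$k - P$k)"
proof -
  have "u (linepath P Q t) \<bullet> (Q - P) = u P $ k * (Q$k - P$k)" for t
  proof -
    have "linepath P Q t $ (k+1) = P$(k+1)"
      using assms(2) by (simp add: linepath_def algebra_simps)
    then have "u (linepath P Q t) $ k = u P $ k"
      using assms(1) unfolding N0_rect_iff by auto
    moreover have "(Q - P) $ (k+1) = 0" using assms(2) by simp
    ultimately show ?thesis using exhaust_2[of k] by (auto simp: inner_vec_2)
  qed
  then show ?thesis by (simp add: tangential_integral_def)
qed

lemma N0_rect_component_interpolation:
  assumes "u \<in> N0_rect" "u R $ k = 0" "P$(k+1) \<noteq> R$(k+1)"
  shows "u x $ k = u P $ k * ((x$(k+1) - R$(k+1)) / (P$(k+1) - R$(k+1)))"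
proof -
  obtain p q where coefficients: "\<And>x k. u x $ k = p k + q k * x$(k+1)"
    using assms(1) unfolding N0_rect_iff by blast
  then have "p k = - (q k * R$(k+1))" using assms(2) by simp
  then have "u y $ k = q k * (y$(k+1) - R$(k+1))" for y
    by (simp add: coefficients algebra_simps)
  then show ?thesis using assms(3) by simp
qed

lemma closed_segment_nth_const:
  fixes P Q x :: "real^'n"
  assumes "x \<in> closed_segment P Q" "P$k = Q$k"
  shows "x$k = P$k"
proof -
  obtain u where "x = (1 - u) *\<^sub>R P + u *\<^sub>R Q" using assms(1) unfolding in_segment by blast
  then have "x$k = (1 - u) * P$k + u * Q$k" by simp
  then show ?thesis using assms(2) by (simp add: algebra_simps)
qed

definition shear_field :: "2 \<Rightarrow> real \<Rightarrow> real \<Rightarrow> vfield" where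
  "shear_field k z h x = axis k ((x$(k+1) - z) / h)"

lemma shear_field_nth [simp]:
  "shear_field k z h x $ k = (x$(k+1) - z) / h"
  "shear_field k z h x $ (k+1) = 0"
  by (simp_all add: shear_field_def axis_def)

lemma shear_field_in_N0_rect: "shear_field k z h \<in> N0_rect"
proof -
  have "shear_field k z h x $ j
      = (if j = k then - z / h else 0) + (if j = k then 1 / h else 0) * x$(j+1)" for x j
    by (simp add: shear_field_def axis_def diff_divide_distrib)
  then show ?thesis unfolding N0_rect_iff by (intro exI allI)
qed

lemma ex1_N0_rect_edge_fun:
  assumes "P$(k+1) = Q$(k+1)" "P$k \<noteq> Q$k" "R$(k+1) = S$(k+1)" "P$(k+1) \<noteq> R$(k+1)"
  shows "\<exists>!\<Phi>. \<Phi> \<in> N0_rect \<and> (\<forall>x. \<Phi> x $ (k+1) = 0) \<and> tangential_integral (P, Q) \<Phi> = 1 \<and>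
    (\<forall>x \<in> closed_segment R S. \<Phi> x = 0)" (is "\<exists>!\<Phi>. ?edge_fun \<Phi>")
proof -
  define h where "h = (P$(k+1) - R$(k+1)) * (Q$k - P$k)"
  have "h \<noteq> 0" using assms(2,4) by (simp add: h_def)
  let ?\<Psi> = "shear_field k (R$(k+1)) h"
  have "tangential_integral (P, Q) ?\<Psi> = 1"
    using \<open>h \<noteq> 0\<close>
    by (simp add: tangential_integral_N0_rect[OF shear_field_in_N0_rect assms(1)] h_def)
  moreover have "?\<Psi> x = 0" if "x \<in> closed_segment R S" for x
    using closed_segment_nth_const[OF that assms(3)] by (simp add: shear_field_def)
  ultimately have "?edge_fun ?\<Psi>" by (simp add: shear_field_in_N0_rect)
  moreover have "\<Phi> = ?\<Psi>" if \<Phi>: "?edge_fun \<Phi>" for \<Phi>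
  proof -
    have "\<Phi> R = 0" using \<Phi> by auto
    moreover have "\<Phi> P $ k * (Q$k - P$k) = 1"
      using \<Phi> tangential_integral_N0_rect[OF _ assms(1)] by metis
    then have "\<Phi> P $ k = 1 / (Q$k - P$k)" using assms(2) by (simp add: field_simps)
    ultimately have "\<Phi> x $ k = ?\<Psi> x $ k" for x
      using \<Phi> N0_rect_component_interpolation[of \<Phi> R k P x] assms(4) by (simp add: h_def)
    then have "\<Phi> x $ j = ?\<Psi> x $ j" for x j
      using \<Phi> eq_or_eq_add_1[of j k] by auto
    then show ?thesis by (simp add: fun_eq_iff vec_eq_iff)
  qed
  ultimately show ?thesis by (rule ex1I)
qed

primrec rect_axis :: "rect_dof \<Rightarrow> 2" where
  "rect_axis (Hor i) = 1"
| "rect_axis (Ver j) = 2"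

primrec opposite_edge :: "rect_dof \<Rightarrow> rect_dof" where
  "opposite_edge (Hor i) = Hor (i + 1)"
| "opposite_edge (Ver j) = Ver (j + 1)"

lemma rect_axis_opposite_edge [simp]: "rect_axis (opposite_edge d) = rect_axis d"
  by (cases d) simp_all

lemma rect_dof_cases:
  obtains (same) "p = d" | (opposite) "p = opposite_edge d"
    | (perpendicular) "rect_axis p = rect_axis d + 1"
  using eq_or_eq_add_1 by (cases p; cases d) fastforce+

lemma rect_basis_eq_The:
  "rect_basis a b d = (THE \<Phi>. \<Phi> \<in> N0_rect \<and> (\<forall>x. \<Phi> x $ (rect_axis d + 1) = 0) \<and>
     tangential_integral (rect_edge a b d) \<Phi> = 1 \<and>
     (\<forall>x \<in> closed_segment (fst (rect_edge a b (opposite_edge d)))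
          (snd (rect_edge a b (opposite_edge d))). \<Phi> x = 0))"
  by (cases d) simp_all

lemma rect_edge_coordinates:
  "fst (rect_edge a b d) $ rect_axis d = a $ rect_axis d"
  "snd (rect_edge a b d) $ rect_axis d = b $ rect_axis d"
  "fst (rect_edge a b d) $ (rect_axis d + 1) = snd (rect_edge a b d) $ (rect_axis d + 1)"
  by (cases d; simp add: Let_def)+

context
  fixes a b :: "real^2"
  assumes proper: "proper_rect a b"
begin

lemma proper_rect_neq: "a $ k \<noteq> b $ k"
  using proper exhaust_2[of k] by (auto simp: proper_rect_def)

lemma opposite_edges_apart:
  "fst (rect_edge a b d) $ (rect_axis d + 1)
    \<noteq> fst (rect_edge a b (opposite_edge d)) $ (rect_axis d + 1)"
proof (cases d)
  case (Hor i)
  then show ?thesis using exhaust_2[of i] proper_rect_neq[of 2] by (auto simp: Let_def)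
next
  case (Ver j)
  then show ?thesis using exhaust_2[of j] proper_rect_neq[of 1] by (auto simp: Let_def)
qed

lemma
  shows rect_basis_in_N0_rect: "rect_basis a b d \<in> N0_rect"
    and rect_basis_normal_component: "rect_basis a b d x $ (rect_axis d + 1) = 0"
    and rect_basis_opposite_edge:
      "x \<in> closed_segment (fst (rect_edge a b (opposite_edge d)))
         (snd (rect_edge a b (opposite_edge d))) \<Longrightarrow> rect_basis a b d x = 0"
proof -
  let ?e = "rect_edge a b d" and ?e' = "rect_edge a b (opposite_edge d)"
  have "\<exists>!\<Phi>. \<Phi> \<in> N0_rect \<and> (\<forall>x. \<Phi> x $ (rect_axis d + 1) = 0) \<and>
    tangential_integral (fst ?e, snd ?e) \<Phi> = 1 \<and>
    (\<forall>x \<in> closed_segment (fst ?e') (snd ?e'). \<Phi> x = 0)"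
    using rect_edge_coordinates[of a b d] rect_edge_coordinates(3)[of a b "opposite_edge d"]
      opposite_edges_apart[of d] proper_rect_neq
    by (intro ex1_N0_rect_edge_fun) simp_all
  note edge_fun = theI'[OF this, unfolded prod.collapse, folded rect_basis_eq_The]
  show "rect_basis a b d \<in> N0_rect" "rect_basis a b d x $ (rect_axis d + 1) = 0"
    "x \<in> closed_segment (fst ?e') (snd ?e') \<Longrightarrow> rect_basis a b d x = 0"
    using edge_fun by blast+
qed

lemma rect_basis_midpoint:
  assumes "p \<noteq> d"
  shows "rect_basis a b p (rect_midpoint a b d) $ rect_axis d = 0"
proof (cases d p rule: rect_dof_cases)
  case opposite
  then have "rect_midpoint a b d \<in> closed_segment (fst (rect_edge a b (opposite_edge p)))
      (snd (rect_edge a b (opposite_edge p)))"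
    by (simp add: rect_midpoint_def)
  then show ?thesis by (simp add: rect_basis_opposite_edge)
next
  case perpendicular
  then show ?thesis by (simp add: rect_basis_normal_component)
qed (use assms in simp)

lemma rect_mass_matrix_diagonal:
  "diagonal_on UNIV (gram (local_quad (Rectangle a b)) (rect_basis a b))"
  unfolding diagonal_on_def gram_def
proof (intro ballI impI)
  fix p q :: rect_dof assume "p \<noteq> q"
  then have products: "rect_basis a b p (rect_midpoint a b d) $ rect_axis d *
      rect_basis a b q (rect_midpoint a b d) $ rect_axis d = 0" for d
    using rect_basis_midpoint[of p d] rect_basis_midpoint[of q d] by fastforce
  have horizontal: "rect_basis a b p (rect_midpoint a b (Hor i)) $ 1 *
      rect_basis a b q (rect_midpoint a b (Hor i)) $ 1 = 0"
    and vertical: "rect_basis a b p (rect_midpoint a b (Ver i)) $ 2 *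
      rect_basis a b q (rect_midpoint a b (Ver i)) $ 2 = 0" for i
    using products[of "Hor i"] products[of "Ver i"] by (simp_all del: rect_basis.simps)
  show "local_quad (Rectangle a b) (rect_basis a b p) (rect_basis a b q) = 0"
    by (simp only: local_quad.simps horizontal vertical) simp
qed

end


section \<open>Element polynomials are determined by their interior values\<close>

lemma N0_tri_iff: "u \<in> N0_tri \<longleftrightarrow> (\<exists>p b. \<forall>x. u x = p + b *\<^sub>R perp x)"
proof
  assume "u \<in> N0_tri"
  then obtain a b c where "\<And>x. u x = vector [a - b * x$2, c + b * x$1]"
    unfolding N0_tri_def by blast
  then have "\<forall>x. u x = vector [a, c] + b *\<^sub>R perp x"
    by (simp add: vec_eq_iff_2 perp_def)
  then show "\<exists>p b. \<forall>x. u x = p + b *\<^sub>R perp x" by blast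
next
  assume "\<exists>p b. \<forall>x. u x = p + b *\<^sub>R perp x"
  then obtain p b where "\<And>x. u x = p + b *\<^sub>R perp x" by blast
  then have "\<forall>x. u x = vector [p$1 - b * x$2, p$2 + b * x$1]"
    by (simp add: vec_eq_iff_2 perp_def)
  then show "u \<in> N0_tri" unfolding N0_tri_def by blast
qed

lemma N0_plus_iff:
  "u \<in> N0_plus v \<longleftrightarrow>
    (\<exists>p b c. \<forall>x. u x = p + b *\<^sub>R perp x + (\<Sum>i\<in>UNIV. c i *\<^sub>R tri_bubble v i x))"
proof
  assume "u \<in> N0_plus v"
  then obtain w c where "w \<in> N0_tri"
    and decomposition: "u = (\<lambda>x. w x + (\<Sum>i\<in>UNIV. c i *\<^sub>R tri_bubble v i x))"
    unfolding N0_plus_def by blast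
  then obtain p b where "\<And>x. w x = p + b *\<^sub>R perp x" unfolding N0_tri_iff by blast
  with decomposition show "\<exists>p b c. \<forall>x. u x = p + b *\<^sub>R perp x + (\<Sum>i\<in>UNIV. c i *\<^sub>R tri_bubble v i x)"
    by auto
next
  assume "\<exists>p b c. \<forall>x. u x = p + b *\<^sub>R perp x + (\<Sum>i\<in>UNIV. c i *\<^sub>R tri_bubble v i x)"
  then obtain p b c where
    "u = (\<lambda>x. (\<lambda>x. p + b *\<^sub>R perp x) x + (\<Sum>i\<in>UNIV. c i *\<^sub>R tri_bubble v i x))"
    by (auto simp: fun_eq_iff)
  moreover have "(\<lambda>x. p + b *\<^sub>R perp x) \<in> N0_tri" unfolding N0_tri_iff by blast
  ultimately show "u \<in> N0_plus v" unfolding N0_plus_def mem_Collect_eq by (intro exI conjI)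
qed

lemma local_space_scaleR:
  assumes "u \<in> local_space K"
  shows "(\<lambda>x. s *\<^sub>R u x) \<in> local_space K"
proof (cases K)
  case (Triangle v)
  with assms obtain p b c
    where "\<And>x. u x = p + b *\<^sub>R perp x + (\<Sum>i\<in>UNIV. c i *\<^sub>R tri_bubble v i x)"
    by (auto simp: N0_plus_iff)
  then have "s *\<^sub>R u x
      = s *\<^sub>R p + (s * b) *\<^sub>R perp x + (\<Sum>i\<in>UNIV. (s * c i) *\<^sub>R tri_bubble v i x)" for x
    by (simp add: scaleR_right_distrib scaleR_right.sum)
  then have "(\<lambda>x. s *\<^sub>R u x) \<in> N0_plus v"
    unfolding N0_plus_iff by (intro exI allI)
  with Triangle show ?thesis by simp
next
  case (Rectangle a b)
  with assms obtain p q where "\<And>x k. u x $ k = p k + q k * x $ (k + 1)"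
    by (auto simp: N0_rect_iff)
  then have "(s *\<^sub>R u x) $ k = s * p k + s * q k * x $ (k + 1)" for x k
    by (simp add: algebra_simps)
  then have "(\<lambda>x. s *\<^sub>R u x) \<in> N0_rect"
    unfolding N0_rect_iff by (intro exI allI)
  with Rectangle show ?thesis by simp
qed

lemma tri_bubble_in_N0_plus: "tri_bubble v i \<in> N0_plus v"
proof -
  have "tri_bubble v i x
      = 0 + 0 *\<^sub>R perp x + (\<Sum>j\<in>UNIV. of_bool (j = i) *\<^sub>R tri_bubble v j x)" for x
    by (simp add: sum_cyclic[of _ i])
  then show ?thesis unfolding N0_plus_iff by (intro exI allI)
qed

lemma tri_edge_fun_in_N0_plus:
  assumes "nondegenerate v"
  shows "tri_edge_fun v \<alpha> \<beta> \<gamma> i \<in> N0_plus v"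
proof -
  let ?g = "bary_grad v i" and ?h = "bary_grad v (i+1)"
  let ?c = "\<lambda>j. if j = i then \<alpha> i else if j = i + 1 then \<beta> i else \<gamma> i"
  have "bary v i x *\<^sub>R ?h - bary v (i+1) x *\<^sub>R ?g
      = (?h \<bullet> v$(i+2)) *\<^sub>R ?g - (?g \<bullet> v$(i+1)) *\<^sub>R ?h + (perp ?g \<bullet> ?h) *\<^sub>R perp x" for x
    unfolding inner_scaleR_diff_eq_perp[symmetric]
    by (simp add: bary_eq_inner[OF assms] inner_diff_right algebra_simps)
  then have "tri_edge_fun v \<alpha> \<beta> \<gamma> i x
      = ((?h \<bullet> v$(i+2)) *\<^sub>R ?g - (?g \<bullet> v$(i+1)) *\<^sub>R ?h) + (perp ?g \<bullet> ?h) *\<^sub>R perp x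
        + (\<Sum>j\<in>UNIV. ?c j *\<^sub>R tri_bubble v j x)" for x
    by (simp add: tri_edge_fun_def grad_bary[OF assms] sum_cyclic[of _ i])
  then show ?thesis unfolding N0_plus_iff by (intro exI allI)
qed

lemma continuous_on_tri_bubble:
  assumes "nondegenerate v"
  shows "continuous_on S (tri_bubble v i)"
  unfolding tri_bubble_def[abs_def] grad_bary[OF assms] bary_eq_inner[OF assms]
  by (intro continuous_intros)

lemma continuous_on_local_space:
  assumes "valid_element K" "u \<in> local_space K"
  shows "continuous_on S u"
proof (cases K)
  case (Triangle v)
  with assms(2) obtain p b c
    where "u = (\<lambda>x. p + b *\<^sub>R perp x + (\<Sum>i\<in>UNIV. c i *\<^sub>R tri_bubble v i x))"
    by (auto simp: N0_plus_iff fun_eq_iff)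
  moreover have "continuous_on S (tri_bubble v i)" for i
    using assms(1) Triangle by (simp add: continuous_on_tri_bubble)
  ultimately show ?thesis
    using linear_continuous_on[OF linear_perp[unfolded linear_conv_bounded_linear]]
    by (auto intro!: continuous_intros)
next
  case (Rectangle a b)
  with assms(2) obtain p q where "\<And>x k. u x $ k = p k + q k * x $ (k + 1)"
    by (auto simp: N0_rect_iff)
  then have "u = (\<lambda>x. \<chi> k. p k + q k * x $ (k + 1))"
    by (simp add: fun_eq_iff vec_eq_iff)
  then show ?thesis by (auto intro!: continuous_intros)
qed

lemma region_eq_closure_interior:
  assumes "valid_element K"
  shows "region K = closure (interior (region K))"
proof -
  have "convex (region K)" "closed (region K)"
    by (cases K; simp add: convex_convex_hull compact_imp_closed finite_imp_compact_convex_hull)+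
  moreover have "interior (region K) \<noteq> {}"
  proof (cases K)
    case (Triangle v)
    then have nondegenerate: "nondegenerate v" using assms by simp
    show ?thesis
      using Triangle interior_convex_hull_eq_empty[of "range (($) v)"]
        card_vertices[OF nondegenerate] affine_independent_vertices[OF nondegenerate] by simp
  next
    case (Rectangle a b)
    then have "midpoint a b \<in> box a b"
      using assms by (auto simp: proper_rect_def mem_box_cart forall_2 midpoint_def)
    then show ?thesis using Rectangle by auto
  qed
  ultimately show ?thesis using convex_closure_interior by fastforce
qed

lemma restriction_eq:
  assumes "valid_element K" "p \<in> local_space K" "\<And>x. x \<in> interior (region K) \<Longrightarrow> u x = p x"
    and "x \<in> region K"
  shows "restriction K u x = p x"
proof -
  let ?r = "restriction K u" and ?S = "closure (interior (region K))"
  have restriction: "?r \<in> local_space K \<and> (\<forall>x \<in> interior (region K). u x = ?r x)"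
    unfolding restriction_def by (rule someI[of _ p]) (use assms in auto)
  have "?r x - p x = 0"
  proof (rule continuous_constant_on_closure[of "interior (region K)" "\<lambda>x. ?r x - p x"])
    show "continuous_on ?S (\<lambda>x. ?r x - p x)"
      using restriction assms(1,2) by (intro continuous_on_diff continuous_on_local_space) auto
    show "x \<in> ?S" using assms(4) region_eq_closure_interior[OF assms(1)] by simp
    show "?r y - p y = 0" if "y \<in> interior (region K)" for y
      using restriction assms(3) that by simp
  qed
  then show ?thesis by simp
qed

lemma tri_midpoint_in_region: "tri_midpoint v i \<in> region (Triangle v)"
  by (simp add: tri_midpoint_def midpoints_in_convex_hull hull_inc)

lemma rect_midpoint_in_region:
  assumes "proper_rect a b"
  shows "rect_midpoint a b d \<in> region (Rectangle a b)"
  using assms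
  by (cases d) (auto simp: rect_midpoint_def Let_def midpoint_def mem_box_cart forall_2 proper_rect_def
      field_simps)

lemma local_quad_cong:
  assumes "valid_element K"
    and "\<And>x. x \<in> region K \<Longrightarrow> u x = u' x" "\<And>x. x \<in> region K \<Longrightarrow> w x = w' x"
  shows "local_quad K u w = local_quad K u' w'"
  using assms tri_midpoint_in_region rect_midpoint_in_region
  by (cases K) (simp_all del: region.simps)

lemma local_quad_scaleR:
  "local_quad K (\<lambda>x. s *\<^sub>R u x) (\<lambda>x. t *\<^sub>R w x) = s * t * local_quad K u w"
  by (cases K) (simp_all add: sum_2 sum_3 algebra_simps del: region.simps)


section \<open>Assembly\<close>

lemma mesh_interiors_disjoint:
  assumes "mesh \<Omega> T" "K \<in> T" "K' \<in> T" "K \<noteq> K'"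
  shows "interior (region K) \<inter> interior (region K') = {}"
proof -
  have interior_edge: "interior (convex hull e) = {}" if "e \<in> edges K" for e
    using that
    by (cases K) (auto simp: endpoints_def card_insert_if intro!: empty_interior_convex_hull)
  have "region K \<inter> region K' = {} \<or>
        (\<exists>p. region K \<inter> region K' = {p}) \<or>
        (\<exists>e \<in> edges K. region K \<inter> region K' = convex hull e)"
    using assms unfolding mesh_def by blast
  then have "interior (region K \<inter> region K') = {}"
    using interior_edge by fastforce
  then show ?thesis by simp
qed

lemma zero_ext_on_interior:
  assumes "mesh \<Omega> T" "K \<in> T" "K' \<in> T" "x \<in> interior (region K)"
  shows "zero_ext K' F x = (if K' = K then F x else 0)"
  using mesh_interiors_disjoint[OF assms(1-3)] assms(4) by (auto simp: zero_ext_def)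

lemma inj_endpoints_tri_edge:
  assumes "nondegenerate v"
  shows "inj (\<lambda>i. endpoints (tri_edge v i))"
proof (rule injI)
  fix i j assume "endpoints (tri_edge v i) = endpoints (tri_edge v j)"
  then have "(($) v) ` {i, i+1} = (($) v) ` {j, j+1}"
    by (simp add: endpoints_def tri_edge_def)
  then have "{i, i+1} = {j, j+1}"
    by (simp only: inj_image_eq_iff[OF inj_vertices[OF assms]])
  then show "i = j"
    by (cases j i rule: cyclic_cases) (auto simp: doubleton_eq_iff)
qed

lemma inj_endpoints_rect_edge:
  assumes "proper_rect a b"
  shows "inj (\<lambda>d. endpoints (rect_edge a b d))"
proof (rule injI)
  fix d d' assume "endpoints (rect_edge a b d) = endpoints (rect_edge a b d')"
  then have "rect_midpoint a b d = rect_midpoint a b d'"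
    by (auto simp: endpoints_def rect_midpoint_def doubleton_eq_iff midpoint_sym)
  moreover have "i = j" if "i = 1 \<longleftrightarrow> j = 1" for i j :: 2
    using that exhaust_2[of i] exhaust_2[of j] by auto
  ultimately show "d = d'"
    using assms
    by (cases d; cases d')
      (auto simp: rect_midpoint_def midpoint_def Let_def vec_eq_iff_2 proper_rect_def
        split: if_splits)
qed

lemma diagonal_on_range:
  assumes "diagonal_on UNIV (\<lambda>p q. A (f p) (f q))"
  shows "diagonal_on (range f) A"
  using assms unfolding diagonal_on_def by fastforce

primrec tri_global_dof :: "real^2^3 \<Rightarrow> tri_dof \<Rightarrow> dof" where
  "tri_global_dof v (Tri_Edge i) = Edge_Dof (endpoints (tri_edge v i))"
| "tri_global_dof v (Tri_Bubble i) = Bubble_Dof v i"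

definition element_dofs :: "element \<Rightarrow> dof set" where
  "element_dofs K = Edge_Dof ` edges K \<union> {Bubble_Dof v i | v i. K = Triangle v}"

context
  fixes \<alpha> \<beta> \<gamma> :: "real^2^3 \<Rightarrow> 3 \<Rightarrow> real"
    and ori :: "(real^2) set \<Rightarrow> (real^2) \<times> (real^2)"
begin

primrec element_basis :: "element \<Rightarrow> dof \<Rightarrow> vfield" where
  "element_basis K (Edge_Dof e) = local_edge_fun \<alpha> \<beta> \<gamma> e K"
| "element_basis K (Bubble_Dof v i) = tri_bubble v i"

lemma element_basis_in_local_space:
  assumes "valid_element K" "d \<in> element_dofs K"
  shows "element_basis K d \<in> local_space K"
proof (cases K)
  case (Triangle v)
  with assms show ?thesis
    by (auto simp: element_dofs_def tri_edge_fun_in_N0_plus tri_bubble_in_N0_plus)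
next
  case (Rectangle a b)
  with assms show ?thesis
    by (auto simp: element_dofs_def rect_basis_in_N0_rect simp del: rect_basis.simps)
qed

lemma element_mass_matrix_diagonal:
  assumes "valid_element K"
    and "\<And>v. K = Triangle v \<Longrightarrow> normal_components_vanish v (\<alpha> v) (\<beta> v) (\<gamma> v)"
  shows "diagonal_on (element_dofs K) (gram (local_quad K) (element_basis K))"
proof (cases K)
  case (Triangle v)
  then have nondegenerate: "nondegenerate v" using assms(1) by simp
  have "element_basis K (tri_global_dof v p) = tri_basis v (\<alpha> v) (\<beta> v) (\<gamma> v) p" for p
    by (cases p) (simp_all add: Triangle inj_eq[OF inj_endpoints_tri_edge[OF nondegenerate]])
  then have "diagonal_on (range (tri_global_dof v)) (gram (local_quad K) (element_basis K))"
    using tri_mass_matrix_diagonal[OF nondegenerate assms(2)[OF Triangle]] Triangle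
    by (intro diagonal_on_range) (simp add: gram_def[abs_def] del: local_quad.simps)
  moreover have "element_dofs K \<subseteq> range (tri_global_dof v)"
    by (auto simp: element_dofs_def Triangle simp flip: tri_global_dof.simps)
  ultimately show ?thesis unfolding diagonal_on_def by blast
next
  case (Rectangle a b)
  then have proper: "proper_rect a b" using assms(1) by simp
  let ?global_dof = "\<lambda>d. Edge_Dof (endpoints (rect_edge a b d))"
  have "element_basis K (?global_dof d) = rect_basis a b d" for d
    by (simp add: Rectangle inj_eq[OF inj_endpoints_rect_edge[OF proper]] del: rect_basis.simps)
  then have "diagonal_on (range ?global_dof) (gram (local_quad K) (element_basis K))"
    using rect_mass_matrix_diagonal[OF proper] Rectangle
    by (intro diagonal_on_range) (simp add: gram_def[abs_def] del: local_quad.simps)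
  moreover have "element_dofs K = range ?global_dof"
    by (simp add: element_dofs_def Rectangle image_image)
  ultimately show ?thesis by simp
qed

definition dof_coeff :: "element \<Rightarrow> dof \<Rightarrow> real" where
  "dof_coeff K d = (if d \<in> element_dofs K
     then (case d of
         Edge_Dof e \<Rightarrow> edge_sign (ori e) (local_edge_fun \<alpha> \<beta> \<gamma> e K)
       | Bubble_Dof v i \<Rightarrow> 1)
     else 0)"

lemma dof_coeff_scaleR_in_local_space:
  assumes "valid_element K"
  shows "(\<lambda>x. dof_coeff K d *\<^sub>R element_basis K d x) \<in> local_space K"
proof (cases "d \<in> element_dofs K")
  case True
  then show ?thesis
    using assms by (intro local_space_scaleR element_basis_in_local_space)
next
  case False
  obtain e where "e \<in> edges K" by (cases K) auto
  then have "(\<lambda>x. 0 *\<^sub>R element_basis K (Edge_Dof e) x) \<in> local_space K"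
    using assms by (intro local_space_scaleR element_basis_in_local_space) (auto simp: element_dofs_def)
  with False show ?thesis by (simp add: dof_coeff_def)
qed

context
  fixes \<Omega> T
  assumes mesh: "mesh \<Omega> T"
begin

lemma global_basis_on_interior:
  assumes "K \<in> T" "d \<in> dofs T" "x \<in> interior (region K)"
  shows "global_basis T \<alpha> \<beta> \<gamma> ori d x = dof_coeff K d *\<^sub>R element_basis K d x"
proof (cases d)
  case (Edge_Dof e)
  let ?f = "\<lambda>K y. edge_sign (ori e) (local_edge_fun \<alpha> \<beta> \<gamma> e K) *\<^sub>R local_edge_fun \<alpha> \<beta> \<gamma> e K y"
  have "finite T" using mesh by (simp add: mesh_def)
  have "global_basis T \<alpha> \<beta> \<gamma> ori d x = (\<Sum>K' \<in> {K' \<in> T. e \<in> edges K'}. zero_ext K' (?f K') x)"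
    by (simp add: Edge_Dof)
  also have "\<dots> = (\<Sum>K' \<in> {K' \<in> T. e \<in> edges K'}. if K' = K then ?f K x else 0)"
    by (rule sum.cong) (auto simp: zero_ext_on_interior[OF mesh assms(1) _ assms(3)])
  also have "\<dots> = (if e \<in> edges K then ?f K x else 0)"
    using \<open>finite T\<close> assms(1) by simp
  also have "\<dots> = dof_coeff K d *\<^sub>R element_basis K d x"
    by (auto simp: Edge_Dof dof_coeff_def element_dofs_def)
  finally show ?thesis .
next
  case (Bubble_Dof v i)
  then have "Triangle v \<in> T" using assms(2) by (auto simp: dofs_def)
  then show ?thesis
    using zero_ext_on_interior[OF mesh assms(1) _ assms(3)]
    by (auto simp: Bubble_Dof dof_coeff_def element_dofs_def)
qed

lemma global_mass_matrix_assembly: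
  assumes "d \<in> dofs T" "d' \<in> dofs T"
  shows "gram (global_quad T) (global_basis T \<alpha> \<beta> \<gamma> ori) d d' =
    (\<Sum>K\<in>T. dof_coeff K d * dof_coeff K d' * gram (local_quad K) (element_basis K) d d')"
  unfolding gram_def global_quad_def
proof (rule sum.cong[OF refl])
  fix K assume "K \<in> T"
  then have valid: "valid_element K" using mesh by (simp add: mesh_def)
  have "restriction K (global_basis T \<alpha> \<beta> \<gamma> ori c) x = dof_coeff K c *\<^sub>R element_basis K c x"
    if "c \<in> dofs T" "x \<in> region K" for c x
    using that valid \<open>K \<in> T\<close> global_basis_on_interior
    by (intro restriction_eq dof_coeff_scaleR_in_local_space)
  with assms show "local_quad K (restriction K (global_basis T \<alpha> \<beta> \<gamma> ori d))
        (restriction K (global_basis T \<alpha> \<beta> \<gamma> ori d'))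
      = dof_coeff K d * dof_coeff K d' * local_quad K (element_basis K d) (element_basis K d')"
    unfolding local_quad_scaleR[symmetric] by (intro local_quad_cong[OF valid])
qed

lemma global_mass_matrix_diagonal:
  assumes "\<And>v. Triangle v \<in> T \<Longrightarrow> normal_components_vanish v (\<alpha> v) (\<beta> v) (\<gamma> v)"
  shows "diagonal_on (dofs T) (gram (global_quad T) (global_basis T \<alpha> \<beta> \<gamma> ori))"
  unfolding diagonal_on_def
proof (intro ballI impI)
  fix d d' assume dofs: "d \<in> dofs T" "d' \<in> dofs T" and "d \<noteq> d'"
  have "dof_coeff K d * dof_coeff K d' * gram (local_quad K) (element_basis K) d d' = 0"
    if "K \<in> T" for K
  proof (cases "d \<in> element_dofs K \<and> d' \<in> element_dofs K")
    case True
    have "valid_element K" using mesh that by (simp add: mesh_def)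
    then have "diagonal_on (element_dofs K) (gram (local_quad K) (element_basis K))"
      using assms that by (intro element_mass_matrix_diagonal) auto
    then show ?thesis using True \<open>d \<noteq> d'\<close> by (simp add: diagonal_on_def)
  qed (auto simp: dof_coeff_def)
  then show "gram (global_quad T) (global_basis T \<alpha> \<beta> \<gamma> ori) d d' = 0"
    unfolding global_mass_matrix_assembly[OF dofs] by (intro sum.neutral ballI)
qed

end

end

theorem mainTheorem2:
  shows "(\<forall>v. nondegenerate v \<longrightarrow>
            (\<exists>\<alpha> \<beta> \<gamma>. normal_components_vanish v \<alpha> \<beta> \<gamma>) \<and>
            (\<forall>\<alpha> \<beta> \<gamma>. normal_components_vanish v \<alpha> \<beta> \<gamma> \<longrightarrow>
               diagonal_on UNIV (gram (local_quad (Triangle v)) (tri_basis v \<alpha> \<beta> \<gamma>))))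
       \<and> (\<forall>a b. proper_rect a b \<longrightarrow>
            diagonal_on UNIV (gram (local_quad (Rectangle a b)) (rect_basis a b)))
       \<and> (\<forall>\<Omega> T ori \<alpha> \<beta> \<gamma>.
            bounded_lipschitz_polygon \<Omega> \<and> mesh \<Omega> T \<and> edge_orientation T ori \<and>
            (\<forall>v. Triangle v \<in> T \<longrightarrow> normal_components_vanish v (\<alpha> v) (\<beta> v) (\<gamma> v)) \<longrightarrow>
            diagonal_on (dofs T) (gram (global_quad T) (global_basis T \<alpha> \<beta> \<gamma> ori)))"
proof (intro conjI allI impI)
  fix v assume "nondegenerate v"
  then show "\<exists>\<alpha> \<beta> \<gamma>. normal_components_vanish v \<alpha> \<beta> \<gamma>"
    by (rule normal_components_vanish_exists)
next
  fix v \<alpha> \<beta> \<gamma> assume "nondegenerate v" "normal_components_vanish v \<alpha> \<beta> \<gamma>"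
  then show "diagonal_on UNIV (gram (local_quad (Triangle v)) (tri_basis v \<alpha> \<beta> \<gamma>))"
    by (rule tri_mass_matrix_diagonal)
next
  fix a b assume "proper_rect a b"
  then show "diagonal_on UNIV (gram (local_quad (Rectangle a b)) (rect_basis a b))"
    by (rule rect_mass_matrix_diagonal)
next
  fix \<Omega> T ori \<alpha> \<beta> \<gamma>
  assume "bounded_lipschitz_polygon \<Omega> \<and> mesh \<Omega> T \<and> edge_orientation T ori \<and>
    (\<forall>v. Triangle v \<in> T \<longrightarrow> normal_components_vanish v (\<alpha> v) (\<beta> v) (\<gamma> v))"
  then show "diagonal_on (dofs T) (gram (global_quad T) (global_basis T \<alpha> \<beta> \<gamma> ori))"
    by (intro global_mass_matrix_diagonal) auto
qed

end
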